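(* Let $\chi$ be a nonlinear kernel with data $(L,\psi,\alpha,\beta)$ relative to $\Pi=(t_k)_{k\in\mathbb{Z}}$, and let $\varphi$ be a convex $\varphi$-function. For every $f\in C_c(\mathbb{R}^+)$ and every $\lambda>0$, $$\lim_{w\to+\infty}I^\varphi_\mu\big[\lambda\,(K^\chi_wf-f)\big]=0.$$
   Context: Notation: $\mathbb{R}^+=(0,\infty)$, $\mathbb{R}^+_0=[0,\infty)$; $\mu$ is the logarithmic (Haar) measure $\mu(A)=\int_A \frac{dt}{t}$ on $\mathbb{R}^+$, and $L^1_\mu(\mathbb{R}^+)$ the corresponding Lebesgue space. $C_c(\mathbb{R}^+)$ is the space of continuous functions $\mathbb{R}^+\to\mathbb{R}$ with compact support in $\mathbb{R}^+$. A $\varphi$-function is a function $\varphi:\mathbb{R}^+_0\to\mathbb{R}^+_0$ that is non-decreasing and continuous, with $\varphi(0)=0$, $\varphi(u)>0$ for $u>0$, and $\varphi(u)\to+\infty$ as $u\to+\infty$. The associated modular is $I^\varphi_\mu[f]:=\int_0^{+\infty}\varphi(|f(x)|)\frac{dx}{x}$ for measurable $f:\mathbb{R}^+\to\mathbb{R}$. $\Pi=(t_k)_{k\in\mathbb{Z}}$ is a sequence of real numbers with $t_k<t_{k+1}$, $\lim_{k\to\pm\infty}t_k=\pm\infty$, for which there are constants $\Delta,\delta>0$ with $\delta\le\Delta_k:=t_{k+1}-t_k\le\Delta$ for every $k\in\mathbb{Z}$. A nonlinear kernel with data $(L,\psi,\alpha,\beta)$, where $L:\mathbb{R}^+\to\mathbb{R}^+_0$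 is measurable, $\psi:\mathbb{R}^+_0\to\mathbb{R}^+_0$ is non-decreasing and continuous with $\psi(0)=0$, and $\alpha,\beta>0$, is a function $\chi:\mathbb{R}^+\times\mathbb{R}\to\mathbb{R}$ such that: (1) $(\chi(e^{-t_k}x^w,u))_k\in\ell^1(\mathbb{Z})$ for every $x\in\mathbb{R}^+$, $u\in\mathbb{R}$, $w>0$; (2) $\chi(x,0)=0$ for every $x\in\mathbb{R}^+$; (3) $|\chi(x,u)-\chi(x,v)|\le L(x)\,\psi(|u-v|)$ for every $x\in\mathbb{R}^+$, $u,v\in\mathbb{R}$; (4) for every $j\in\mathbb{N}$ ($j\ge1$), $$\mathcal{S}^j_w(x):=\sup_{0\le|u|<1/j}\Big|\sum_{k\in\mathbb{Z}}\chi(e^{-t_k}x^w,u)-u\Big|=\mathcal{O}(w^{-\alpha}),\qquad \mathcal{T}^j_w(x):=\sup_{|u|\ge1/j}\Big|\frac1u\sum_{k\in\mathbb{Z}}\chi(e^{-t_k}x^w,u)-1\Big|=\mathcal{O}(w^{-\alpha})$$ as $w\to+\infty$, uniformly with respect to $x\in\mathbb{R}^+$; (5) $L\in L^1_\mu(\mathbb{R}^+)$ and $L$ is bounded; (6) $M_{\beta,\Pi}(L)<+\infty$, where $M_{\beta,\Pi}(L):=\sup_{x\in\mathbb{R}^+}\sum_{k\in\mathbb{Z}}L(e^{-t_k}x)\,|\ln x-t_k|^\beta$. For $w>0$ and a locally integrable $f:\mathbb{R}^+\to\mathbb{R}$ for which the series converges for every $x$, the nonlinear exponential Kantorovich sampling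 operator is $$(K^\chi_w f)(x):=\sum_{k\in\mathbb{Z}}\chi\Big(e^{-t_k}x^w,\ \frac{w}{\Delta_k}\int_{t_k/w}^{t_{k+1}/w}f(e^u)\,du\Big),\qquad x\in\mathbb{R}^+.$$ *)

theory Defs
  imports "HOL-Analysis.Analysis"
begin

text \<open>Functions on \<open>(0,\<infinity>)\<close> or \<open>[0,\<infinity>)\<close> are total functions on
  \<^typ>\<open>real\<close> whose values off that domain are unconstrained and never used.
  Measurability on \<open>(0,\<infinity>)\<close> is in the sense of Lebesgue.\<close>

definition log_measure :: "real measure" where
  "log_measure = density (lebesgue_on {0<..}) (\<lambda>x. ennreal (1 / x))"

definition Cc_pos :: "(real \<Rightarrow> real) set" where
  "Cc_pos = {f. continuous_on {0<..} f \<and>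
     compact (closure (support_on {0<..} f)) \<and> closure (support_on {0<..} f) \<subseteq> {0<..}}"

definition phi_function :: "(real \<Rightarrow> real) \<Rightarrow> bool" where
  "phi_function \<phi> \<longleftrightarrow>
     (\<forall>u\<ge>0. \<phi> u \<ge> 0) \<and> mono_on {0..} \<phi> \<and> continuous_on {0..} \<phi> \<and>
     \<phi> 0 = 0 \<and> (\<forall>u>0. \<phi> u > 0) \<and> filterlim \<phi> at_top at_top"

text \<open>No measurability of a kernel in its first argument is assumed below, so \<open>f\<close> need not be
  measurable here; for measurable \<open>f\<close> this is the usual integral.\<close>

definition log_modular :: "(real \<Rightarrow> real) \<Rightarrow> (real \<Rightarrow> real) \<Rightarrow> ennreal" where
  "log_modular \<phi> f = (\<integral>\<^sup>+ x. ennreal (\<phi> \<bar>f x\<bar>) \<partial>log_measure)"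

definition sampling_sequence :: "(int \<Rightarrow> real) \<Rightarrow> bool" where
  "sampling_sequence t \<longleftrightarrow>
     (\<forall>k. t k < t (k + 1)) \<and> filterlim t at_top at_top \<and> filterlim t at_bot at_bot \<and>
     (\<exists>\<Delta>>0. \<exists>\<delta>>0. \<forall>k. \<delta> \<le> t (k + 1) - t k \<and> t (k + 1) - t k \<le> \<Delta>)"

text \<open>The suprema \<open>S\<close>, \<open>T\<close> and \<open>M\<close> are taken in \<^typ>\<open>ennreal\<close>, so that
  an unbounded family or a divergent series gives \<open>\<infinity>\<close>.\<close>

definition kernel_S :: "(int \<Rightarrow> real) \<Rightarrow> (real \<Rightarrow> real \<Rightarrow> real) \<Rightarrow> nat \<Rightarrow> real \<Rightarrow> real \<Rightarrow> ennreal" where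
  "kernel_S t chi j w x =
     (SUP u\<in>{u. \<bar>u\<bar> < 1 / real j}.
        ennreal \<bar>(\<Sum>\<^sub>\<infinity>k\<in>UNIV. chi (exp (- t k) * x powr w) u) - u\<bar>)"

definition kernel_T :: "(int \<Rightarrow> real) \<Rightarrow> (real \<Rightarrow> real \<Rightarrow> real) \<Rightarrow> nat \<Rightarrow> real \<Rightarrow> real \<Rightarrow> ennreal" where
  "kernel_T t chi j w x =
     (SUP u\<in>{u. \<bar>u\<bar> \<ge> 1 / real j}.
        ennreal \<bar>1 / u * (\<Sum>\<^sub>\<infinity>k\<in>UNIV. chi (exp (- t k) * x powr w) u) - 1\<bar>)"

definition abs_moment :: "real \<Rightarrow> (int \<Rightarrow> real) \<Rightarrow> (real \<Rightarrow> real) \<Rightarrow> ennreal" where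
  "abs_moment \<beta> t L =
     (SUP x\<in>{0<..}. \<Sum>\<^sub>\<infinity>k\<in>UNIV. ennreal (L (exp (- t k) * x) * \<bar>ln x - t k\<bar> powr \<beta>))"

text \<open>\<open>G w x = O(w\<^sup>-\<^sup>\<alpha>)\<close> as \<open>w \<rightarrow> \<infinity>\<close>, uniformly in \<open>x > 0\<close>.\<close>

definition uniform_bigo_powr :: "real \<Rightarrow> (real \<Rightarrow> real \<Rightarrow> ennreal) \<Rightarrow> bool" where
  "uniform_bigo_powr \<alpha> G \<longleftrightarrow>
     (\<exists>C::real. \<forall>\<^sub>F w in at_top. \<forall>x>0. G w x \<le> ennreal (C * w powr (- \<alpha>)))"

definition nonlinear_kernel ::
  "(int \<Rightarrow> real) \<Rightarrow> (real \<Rightarrow> real) \<Rightarrow> (real \<Rightarrow> real) \<Rightarrow> real \<Rightarrow> real \<Rightarrow>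
   (real \<Rightarrow> real \<Rightarrow> real) \<Rightarrow> bool" where
  "nonlinear_kernel t L \<psi> \<alpha> \<beta> chi \<longleftrightarrow>
     (\<forall>x>0. L x \<ge> 0) \<and> L \<in> borel_measurable (lebesgue_on {0<..}) \<and>
     (\<forall>u\<ge>0. \<psi> u \<ge> 0) \<and> mono_on {0..} \<psi> \<and> continuous_on {0..} \<psi> \<and> \<psi> 0 = 0 \<and>
     \<alpha> > 0 \<and> \<beta> > 0 \<and>
     (\<forall>x>0. \<forall>u. \<forall>w>0. (\<lambda>k. \<bar>chi (exp (- t k) * x powr w) u\<bar>) summable_on UNIV) \<and>
     (\<forall>x>0. chi x 0 = 0) \<and>
     (\<forall>x>0. \<forall>u v. \<bar>chi x u - chi x v\<bar> \<le> L x * \<psi> \<bar>u - v\<bar>) \<and>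
     (\<forall>j\<ge>1. uniform_bigo_powr \<alpha> (kernel_S t chi j) \<and> uniform_bigo_powr \<alpha> (kernel_T t chi j)) \<and>
     integrable log_measure L \<and> bounded (L ` {0<..}) \<and>
     abs_moment \<beta> t L < \<infinity>"

text \<open>The sum is the intended one only for \<open>f\<close> whose series converges at every \<open>x > 0\<close>.
  This holds for \<open>f\<close> in \<^const>\<open>Cc_pos\<close>: only finitely many of the means are nonzero, and
  \<open>chi x 0 = 0\<close>.\<close>

definition Kantorovich ::
  "(int \<Rightarrow> real) \<Rightarrow> (real \<Rightarrow> real \<Rightarrow> real) \<Rightarrow> real \<Rightarrow> (real \<Rightarrow> real) \<Rightarrow> real \<Rightarrow> real" where
  "Kantorovich t chi w f x =
     (\<Sum>\<^sub>\<infinity>k\<in>UNIV. chi (exp (- t k) * x powr w)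
        (w / (t (k + 1) - t k) * (LBINT u:{t k / w..t (k + 1) / w}. f (exp u))))"

end

theory Submission
  imports Defs
begin

text \<open>In the coordinate \<open>s = ln x\<close> the measure becomes Lebesgue measure and \<open>f\<close> a uniformly
  continuous function vanishing for \<open>\<bar>s\<bar> > R\<close>. Splitting the series at \<open>\<bar>w s - t\<^sub>k\<bar> < w \<rho> / 2\<close>,
  where uniform continuity applies, and using the moment condition for the other \<open>k\<close>, gives
  \<open>K\<^sub>w f \<longlongrightarrow> f\<close> uniformly, which settles \<open>\<bar>s\<bar> \<le> R + 2\<close>. For \<open>\<bar>s\<bar> > R + 2\<close> only the \<open>O(w)\<close> indices
  with \<open>\<bar>t\<^sub>k\<bar> \<le> w (R + 1)\<close> contribute. There convexity bounds the integrand by a constant times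
  \<open>\<Sum>\<^sub>k L(exp (w s - t\<^sub>k))\<close>, and since \<open>\<bar>w s - t\<^sub>k\<bar> > w\<close> each term has integral at most \<open>1 / w\<close>
  times the tail of \<open>\<integral> L(exp s) ds\<close> over \<open>\<bar>s\<bar> > w\<close>, which tends to \<open>0\<close>.\<close>

section \<open>The logarithmic measure in the coordinate s = ln x\<close>

text \<open>The substitution x = exp s is made between the compact intervals [exp (-n), exp n] and
  [-n, n]; monotone convergence in n then exhausts the half-line and the line.\<close>

lemma nn_integral_exp_subst_indicator:
  fixes A :: "real set"
  assumes [measurable]: "A \<in> sets borel"
  shows "(\<integral>\<^sup>+ x. ennreal (1 / x) * indicator {0<..} x * indicator A x \<partial>lborel)
       = (\<integral>\<^sup>+ s. indicator A (exp s) \<partial>lborel)"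
proof -
  define h where "h n x = ennreal (1 / x * indicator A x * indicator {exp (- real n)..exp (real n)} x)"
    for n x
  define k where "k n s = ennreal (indicator A (exp s) * indicator {- real n..real n} s)" for n s
  have eq: "(\<integral>\<^sup>+ x. h n x \<partial>lborel) = (\<integral>\<^sup>+ s. k n s \<partial>lborel)" for n
  proof -
    have "(\<integral>\<^sup>+ x. h n x \<partial>lborel)
        = (\<integral>\<^sup>+ s. ennreal ((1 / exp s * indicator A (exp s)) * exp s * indicator {- real n..real n} s) \<partial>lborel)"
      unfolding h_def
      by (rule nn_integral_substitution[where g' = exp])
        (auto intro!: derivative_eq_intros continuous_intros simp: set_borel_measurable_def)
    then show ?thesis by (simp add: k_def)
  qed
  have incl: "{exp (- real m)..exp (real m)} \<subseteq> {exp (- real n)..exp (real n)}" if "m \<le> n" for m n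
    using that by auto
  have "(\<integral>\<^sup>+ x. ennreal (1 / x) * indicator {0<..} x * indicator A x \<partial>lborel)
      = (\<integral>\<^sup>+ x. (SUP n. h n x) \<partial>lborel)"
  proof (rule nn_integral_cong)
    fix x :: real
    show "ennreal (1 / x) * indicator {0<..} x * indicator A x = (SUP n. h n x)"
    proof (cases "x > 0")
      case True
      obtain n where n: "\<bar>ln x\<bar> \<le> real n" using real_arch_simple by blast
      have mem: "x \<in> {exp (- real n)..exp (real n)}"
      proof -
        have "exp (- real n) \<le> exp (ln x)" "exp (ln x) \<le> exp (real n)" using n by auto
        then show ?thesis using True by simp
      qed
      have "(SUP n. h n x) = ennreal (1 / x * indicator A x)"
      proof (rule antisym)
        show "(SUP n. h n x) \<le> ennreal (1 / x * indicator A x)"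
          using True by (intro SUP_least) (auto simp: h_def indicator_def)
        have "ennreal (1 / x * indicator A x) = h n x" using mem by (simp add: h_def)
        also have "\<dots> \<le> (SUP n. h n x)" by (rule SUP_upper) simp
        finally show "ennreal (1 / x * indicator A x) \<le> (SUP n. h n x)" .
      qed
      then show ?thesis using True by (auto simp: indicator_def)
    next
      case False
      have "h n x = 0" for n
      proof -
        have "0 < exp (- real n)" by simp
        then have "x \<notin> {exp (- real n)..exp (real n)}" using False by (auto simp del: exp_gt_zero)
        then show ?thesis by (simp add: h_def)
      qed
      then show ?thesis using False by simp
    qed
  qed
  also have "\<dots> = (SUP n. \<integral>\<^sup>+ x. h n x \<partial>lborel)"
  proof (rule nn_integral_monotone_convergence_SUP)
    show "incseq h"
    proof (intro incseq_SucI le_funI)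
      fix n x
      show "h n x \<le> h (Suc n) x"
      proof (cases "x \<in> {exp (- real n)..exp (real n)}")
        case True
        moreover have "x \<in> {exp (- real (Suc n))..exp (real (Suc n))}"
          using True incl[OF le_SucI[OF order_refl[of n]]] by blast
        ultimately have "h n x = h (Suc n) x" unfolding h_def by (metis indicator_simps(1))
        then show ?thesis by simp
      qed (simp add: h_def)
    qed
    show "h n \<in> borel_measurable lborel" for n unfolding h_def by measurable
  qed
  also have "\<dots> = (SUP n. \<integral>\<^sup>+ s. k n s \<partial>lborel)" by (simp add: eq)
  also have "\<dots> = (\<integral>\<^sup>+ s. (SUP n. k n s) \<partial>lborel)"
  proof (rule nn_integral_monotone_convergence_SUP[symmetric])
    show "incseq k" by (intro incseq_SucI le_funI) (auto simp: k_def indicator_def)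
    show "k n \<in> borel_measurable lborel" for n unfolding k_def by measurable
  qed
  also have "\<dots> = (\<integral>\<^sup>+ s. indicator A (exp s) \<partial>lborel)"
  proof (rule nn_integral_cong)
    fix s :: real
    obtain n where n: "\<bar>s\<bar> \<le> real n" using real_arch_simple by blast
    show "(SUP n. k n s) = indicator A (exp s)"
    proof (rule antisym)
      show "(SUP n. k n s) \<le> indicator A (exp s)"
        by (intro SUP_least) (auto simp: k_def indicator_def)
      have "indicator A (exp s) = k n s" using n by (auto simp: k_def indicator_def)
      also have "\<dots> \<le> (SUP n. k n s)" by (rule SUP_upper) simp
      finally show "indicator A (exp s) \<le> (SUP n. k n s)" .
    qed
  qed
  finally show ?thesis .
qed

text \<open>By the preceding identity, the Borel measure with density 1 / x on the half-line is the
  image of Lebesgue measure under exp. Borel measurability of \<open>h\<close> permits the passage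
  from the completed measure to \<open>lborel\<close>.\<close>

lemma nn_integral_log_measure:
  fixes h :: "real \<Rightarrow> ennreal"
  assumes [measurable]: "h \<in> borel_measurable borel"
  shows "(\<integral>\<^sup>+ x. h x \<partial>log_measure) = (\<integral>\<^sup>+ s. h (exp s) \<partial>lborel)"
proof -
  let ?d = "\<lambda>x::real. ennreal (1 / x) * indicator {0<..} x"
  have eq: "density lborel ?d = distr lborel borel exp"
  proof (rule measure_eqI)
    fix A assume "A \<in> sets (density lborel ?d)"
    then have [measurable]: "A \<in> sets borel" by simp
    have "emeasure (distr lborel borel exp) A = (\<integral>\<^sup>+ x. indicator A x \<partial>distr lborel borel exp)"
      by simp
    also have "\<dots> = (\<integral>\<^sup>+ s. indicator A (exp s) \<partial>lborel)"
      by (subst nn_integral_distr) auto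
    finally show "emeasure (density lborel ?d) A = emeasure (distr lborel borel exp) A"
      using nn_integral_exp_subst_indicator[of A] by (simp add: emeasure_density)
  qed simp
  have "(\<integral>\<^sup>+ x. h x \<partial>log_measure) = (\<integral>\<^sup>+ x. ennreal (1 / x) * h x \<partial>lebesgue_on {0<..})"
    unfolding log_measure_def by (rule nn_integral_density) (auto intro!: measurable_restrict_space1 measurable_completion)
  also have "\<dots> = (\<integral>\<^sup>+ x. ennreal (1 / x) * h x * indicator {0<..} x \<partial>lebesgue)"
    by (rule nn_integral_restrict_space) auto
  also have "\<dots> = (\<integral>\<^sup>+ x. ?d x * h x \<partial>lborel)"
    by (simp add: nn_integral_completion mult_ac)
  also have "\<dots> = (\<integral>\<^sup>+ x. h x \<partial>density lborel ?d)"
    by (rule nn_integral_density[symmetric]) auto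
  also have "\<dots> = (\<integral>\<^sup>+ s. h (exp s) \<partial>lborel)"
    unfolding eq by (subst nn_integral_distr) auto
  finally show ?thesis .
qed

text \<open>The nonnegative integral is monotone even for a non-measurable smaller function, so
  measurability rests on the majorant \<open>H\<close> alone.\<close>

lemma log_modular_le:
  assumes [measurable]: "H \<in> borel_measurable borel"
    and le: "\<And>s. ennreal (\<phi> \<bar>h (exp s)\<bar>) \<le> H s"
  shows "log_modular \<phi> h \<le> (\<integral>\<^sup>+ s. H s \<partial>lborel)"
proof -
  have "log_modular \<phi> h \<le> (\<integral>\<^sup>+ x. H (ln x) \<partial>log_measure)"
    unfolding log_modular_def
  proof (rule nn_integral_mono)
    fix x assume "x \<in> space log_measure"
    then have "x > 0" by (simp add: log_measure_def space_restrict_space)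
    then show "ennreal (\<phi> \<bar>h x\<bar>) \<le> H (ln x)" using le[of "ln x"] by simp
  qed
  also have "\<dots> = (\<integral>\<^sup>+ s. H s \<partial>lborel)"
    by (subst nn_integral_log_measure) auto
  finally show ?thesis .
qed

text \<open>The majorant dominates everywhere, not just almost everywhere: \<open>chi\<close> need not be
  measurable, so it can only be estimated pointwise.\<close>

lemma borel_majorant_log_measure:
  fixes L :: "real \<Rightarrow> real"
  assumes meas: "L \<in> borel_measurable (lebesgue_on {0<..})"
    and int: "integrable log_measure L"
  obtains G :: "real \<Rightarrow> ennreal" where "G \<in> borel_measurable borel"
    "\<And>s. ennreal (L (exp s)) \<le> G s" "(\<integral>\<^sup>+ s. G s \<partial>lborel) < \<infinity>"
proof -
  have "(\<lambda>x. ennreal (L x)) \<in> borel_measurable (lebesgue_on {0<..})"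
    using meas by measurable
  then have "(\<lambda>x. ennreal (L x) * indicator {0<..} x) \<in> borel_measurable lebesgue"
    by (subst (asm) borel_measurable_restrict_space_iff_ennreal) auto
  then obtain g where g: "g \<in> borel_measurable lborel"
    and ae: "AE x in lborel. ennreal (L x) * indicator {0<..} x = g x"
    using completion_ex_borel_measurable by blast
  from ae obtain N where N: "N \<in> null_sets lborel"
    and sub: "{x \<in> space lborel. ennreal (L x) * indicator {0<..} x \<noteq> g x} \<subseteq> N"
    unfolding eventually_ae_filter by auto
  \<comment> \<open>\<open>g\<close> agrees with \<open>L\<close> only off the null set
    \<open>N\<close>; the value \<infinity> on \<open>N\<close> secures domination at every positive
    point without changing the integral.\<close>
  define g' where "g' x = (if x \<in> N then \<infinity> else g x)" for x
  have [measurable]: "N \<in> sets borel" using N by auto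
  have [measurable]: "g \<in> borel_measurable borel" using g by simp
  have g'm[measurable]: "g' \<in> borel_measurable borel" unfolding g'_def by measurable
  have le: "ennreal (L x) \<le> g' x" if "x > 0" for x
  proof (cases "x \<in> N")
    case False
    then have "ennreal (L x) * indicator {0<..} x = g x" using sub by auto
    then show ?thesis using that False by (simp add: g'_def)
  qed (simp add: g'_def)
  have "AE x in lborel. x \<notin> N" using N by (rule AE_not_in)
  then have "AE x in lebesgue. x \<notin> N" by (rule AE_completion)
  then have "AE x in lebesgue_on {0<..}. x \<notin> N"
    by (subst AE_restrict_space_iff) auto
  moreover have dm: "(\<lambda>x. ennreal (1 / x)) \<in> borel_measurable (lebesgue_on {0<..})"
    by (intro measurable_restrict_space1 measurable_completion) simp
  ultimately have "AE x in log_measure. x \<notin> N"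
    unfolding log_measure_def by (subst AE_density) (auto intro: dm)
  moreover have "AE x in log_measure. x \<in> space log_measure" by (rule AE_space)
  ultimately have "AE x in log_measure. g' x = ennreal (L x)"
  proof eventually_elim
    fix x assume x: "x \<notin> N" "x \<in> space log_measure"
    then have "ennreal (L x) * indicator {0<..} x = g x" using sub by auto
    then show "g' x = ennreal (L x)"
      using x by (simp add: g'_def log_measure_def space_restrict_space)
  qed
  then have "(\<integral>\<^sup>+ x. g' x \<partial>log_measure) = (\<integral>\<^sup>+ x. ennreal (L x) \<partial>log_measure)"
    by (rule nn_integral_cong_AE)
  also have "\<dots> \<le> (\<integral>\<^sup>+ x. ennreal (norm (L x)) \<partial>log_measure)"
    by (intro nn_integral_mono ennreal_leI) simp
  also have "\<dots> < \<infinity>" using int by (simp add: integrable_iff_bounded)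
  finally have "(\<integral>\<^sup>+ s. g' (exp s) \<partial>lborel) < \<infinity>"
    by (simp add: nn_integral_log_measure)
  then show ?thesis
    by (intro that[of "\<lambda>s. g' (exp s)"]) (auto intro: le)
qed

text \<open>Dominated convergence, with \<open>G\<close> itself as the dominating function, gives
  the limit along the integers; this is enough because the tail decreases in w.\<close>

lemma tendsto_nn_integral_tail:
  fixes G :: "real \<Rightarrow> ennreal"
  assumes [measurable]: "G \<in> borel_measurable borel" and fin: "(\<integral>\<^sup>+ s. G s \<partial>lborel) < \<infinity>"
  shows "((\<lambda>w. \<integral>\<^sup>+ s. G s * indicator {s. w < \<bar>s\<bar>} s \<partial>lborel) \<longlongrightarrow> 0) at_top"
proof -
  let ?T = "\<lambda>w. \<integral>\<^sup>+ s. G s * indicator {s. w < \<bar>s\<bar>} s \<partial>lborel"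
  have "(\<lambda>n. \<integral>\<^sup>+ s. G s * indicator {s. real n < \<bar>s\<bar>} s \<partial>lborel) \<longlonglongrightarrow> (\<integral>\<^sup>+ s. 0 \<partial>(lborel::real measure))"
  proof (rule nn_integral_dominated_convergence[where w = G])
    show "AE s in lborel. (\<lambda>n. G s * indicator {s. real n < \<bar>s\<bar>} s) \<longlonglongrightarrow> 0"
    proof (rule AE_I2)
      fix s :: real
      have "\<forall>\<^sub>F n in sequentially. G s * indicator {s. real n < \<bar>s\<bar>} s = 0"
        using eventually_ge_at_top[of "nat \<lceil>\<bar>s\<bar>\<rceil>"]
        by eventually_elim (auto simp: indicator_def nat_le_iff ceiling_le_iff)
      then show "(\<lambda>n. G s * indicator {s. real n < \<bar>s\<bar>} s) \<longlonglongrightarrow> 0"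
        by (rule tendsto_eventually)
    qed
  qed (use fin in \<open>auto simp: indicator_def\<close>)
  then have seq: "(\<lambda>n. ?T (real n)) \<longlonglongrightarrow> 0" by simp
  show ?thesis
  proof (rule order_tendstoI)
    fix e :: ennreal assume "0 < e"
    then have "\<forall>\<^sub>F n in sequentially. ?T (real n) < e"
      using seq by (auto dest: order_tendstoD)
    then obtain n where n: "?T (real n) < e" by (auto simp: eventually_sequentially)
    show "\<forall>\<^sub>F w in at_top. ?T w < e"
      using eventually_ge_at_top[of "real n"]
    proof eventually_elim
      case (elim w)
      have "?T w \<le> ?T (real n)" using elim by (intro nn_integral_mono) (auto simp: indicator_def)
      then show ?case using n by simp
    qed
  qed simp
qed

section \<open>Counting sampling points and summing the kernel\<close>

lemma spaced_diff_ge: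
  fixes t :: "int \<Rightarrow> real"
  assumes "\<And>k. d \<le> t (k + 1) - t k" and "m \<le> n"
  shows "d * real_of_int (n - m) \<le> t n - t m"
  using assms(2)
proof (induction n rule: int_ge_induct)
  case (step i)
  then show ?case using assms(1)[of i] by (simp add: algebra_simps)
qed simp

text \<open>A finite set of such indices lies between its minimum and its maximum, whose difference
  the spacing bounds by (b - a) / d. The bound is the same for all finite subsets and so yields
  finiteness as well.\<close>

lemma spaced_points_in_interval:
  fixes t :: "int \<Rightarrow> real"
  assumes sp: "\<And>k. d \<le> t (k + 1) - t k" and "d > 0" and "a \<le> b"
  shows "finite {k. a \<le> t k \<and> t k \<le> b}"
    and "real (card {k. a \<le> t k \<and> t k \<le> b}) \<le> (b - a) / d + 1"
proof -
  let ?S = "{k. a \<le> t k \<and> t k \<le> b}"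
  have card: "real (card F) \<le> (b - a) / d + 1" if F: "finite F" "F \<subseteq> ?S" for F
  proof (cases "F = {}")
    case False
    have le: "Min F \<le> Max F" using F False by simp
    have "F \<subseteq> {Min F..Max F}" using F by auto
    then have "card F \<le> card {Min F..Max F}" by (rule card_mono[rotated]) simp
    then have "real (card F) \<le> real_of_int (Max F - Min F) + 1" using le by simp
    moreover have "real_of_int (Max F - Min F) \<le> (b - a) / d"
    proof -
      have "Min F \<in> ?S" "Max F \<in> ?S" using F False Min_in Max_in by blast+
      then have "d * real_of_int (Max F - Min F) \<le> b - a"
        using spaced_diff_ge[of d t, OF sp le] by simp
      then show ?thesis using \<open>d > 0\<close> by (simp add: pos_le_divide_eq mult.commute)
    qed
    ultimately show ?thesis by linarith
  qed (use assms in simp)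
  show "finite ?S"
  proof (rule finite_if_finite_subsets_card_bdd[of _ "nat \<lfloor>(b - a) / d + 1\<rfloor>", THEN conjunct1])
    show "card F \<le> nat \<lfloor>(b - a) / d + 1\<rfloor>" if "F \<subseteq> ?S" "finite F" for F
      using card[OF that(2,1)] by linarith
  qed
  then show "real (card ?S) \<le> (b - a) / d + 1" by (rule card) simp
qed

text \<open>The moment evaluated at x = exp y becomes a real bound uniform in y, in the form of
  finite partial sums that the later series estimates use.\<close>

lemma abs_moment_finite_sum:
  assumes fin: "abs_moment \<beta> t L < \<infinity>" and nn: "\<And>x. x > 0 \<Longrightarrow> L x \<ge> 0"
  obtains M where "M \<ge> 0"
    "\<And>y F. finite F \<Longrightarrow> (\<Sum>k\<in>F. L (exp (y - t k)) * \<bar>y - t k\<bar> powr \<beta>) \<le> M"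
proof -
  obtain M where M: "M \<ge> 0" "abs_moment \<beta> t L = ennreal M"
    using fin by (cases "abs_moment \<beta> t L") auto
  have "(\<Sum>k\<in>F. L (exp (y - t k)) * \<bar>y - t k\<bar> powr \<beta>) \<le> M" if "finite F" for y F
  proof -
    let ?h = "\<lambda>k. L (exp (- t k) * exp y) * \<bar>ln (exp y) - t k\<bar> powr \<beta>"
    have "ennreal (\<Sum>k\<in>F. ?h k) = (\<Sum>k\<in>F. ennreal (?h k))"
      by (rule sum_ennreal[symmetric]) (auto intro!: mult_nonneg_nonneg nn)
    also have "\<dots> \<le> (\<Sum>\<^sub>\<infinity>k\<in>UNIV. ennreal (?h k))"
      using that by (subst nonneg_infsum_complete) (auto intro!: SUP_upper)
    also have "\<dots> \<le> abs_moment \<beta> t L"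
      unfolding abs_moment_def by (rule SUP_upper) simp
    finally have "(\<Sum>k\<in>F. ?h k) \<le> M" using M by (simp add: ennreal_le_iff)
    then show ?thesis by (simp add: mult_exp_exp)
  qed
  with M show ?thesis by (intro that) auto
qed

text \<open>Chebyshev's inequality for the weights \<open>a k\<close>: on \<open>F\<close> the
  factor \<open>\<bar>y - t k\<bar> powr \<beta>\<close> is at least
  \<open>r powr \<beta>\<close>.\<close>

lemma far_sum_le:
  assumes M: "\<And>F. finite F \<Longrightarrow> (\<Sum>k\<in>F. a k * \<bar>y - t k\<bar> powr \<beta>) \<le> M"
    and nn: "\<And>k. a k \<ge> (0::real)" and "r > 0" and "\<beta> > 0" and "finite F"
    and far: "\<And>k. k \<in> F \<Longrightarrow> r \<le> \<bar>y - t k\<bar>"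
  shows "(\<Sum>k\<in>F. a k) \<le> M / r powr \<beta>"
proof -
  have "(\<Sum>k\<in>F. a k) * r powr \<beta> \<le> (\<Sum>k\<in>F. a k * \<bar>y - t k\<bar> powr \<beta>)"
    unfolding sum_distrib_right using assms
    by (intro sum_mono mult_left_mono powr_mono2) auto
  also have "\<dots> \<le> M" using assms by simp
  finally show ?thesis using \<open>r > 0\<close> by (simp add: field_simps)
qed

text \<open>Indices with \<open>t k\<close> farther than 1 from y are paid for by the moment bound
  with r = 1. At most 2 / d + 1 indices remain, and each contributes at most the bound of
  \<open>L\<close>.\<close>

lemma kernel_sum_bounded:
  fixes t :: "int \<Rightarrow> real"
  assumes sp: "\<And>k. d \<le> t (k + 1) - t k" "d > 0" and "\<beta> > 0"
    and nn: "\<And>x. x > 0 \<Longrightarrow> L x \<ge> (0::real)" and bdd: "bounded (L ` {0<..})"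
    and M: "\<And>y F. finite F \<Longrightarrow> (\<Sum>k\<in>F. L (exp (y - t k)) * \<bar>y - t k\<bar> powr \<beta>) \<le> M"
  obtains M0 where "M0 > 0" "\<And>y F. finite F \<Longrightarrow> (\<Sum>k\<in>F. L (exp (y - t k))) \<le> M0"
proof -
  obtain b where "\<forall>x\<in>L ` {0<..}. norm x \<le> b"
    using bdd unfolding bounded_iff by blast
  then have b: "L x \<le> b" if "x > 0" for x
    using that abs_le_D1[of "L x" b] by simp
  have b0: "b \<ge> 0" using b[of 1] nn[of 1] by simp
  have M0: "M \<ge> 0" using M[of "{}"] by simp
  \<comment> \<open>The last summand 1 makes the bound strictly positive, so that it can serve as a
    divisor later.\<close>
  have "(\<Sum>k\<in>F. L (exp (y - t k))) \<le> M + (2 / d + 1) * b + 1" if F: "finite F" for y F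
  proof -
    let ?S = "{k. y - 1 \<le> t k \<and> t k \<le> y + 1}"
    note S = spaced_points_in_interval[of d t "y - 1" "y + 1", OF sp]
    have "(\<Sum>k\<in>F. L (exp (y - t k))) = (\<Sum>k\<in>F - ?S. L (exp (y - t k))) + (\<Sum>k\<in>F \<inter> ?S. L (exp (y - t k)))"
      using sum.Int_Diff[OF F, of "\<lambda>k. L (exp (y - t k))" ?S] by simp
    moreover have "(\<Sum>k\<in>F - ?S. L (exp (y - t k))) \<le> M / 1 powr \<beta>"
      by (rule far_sum_le[where y = y and t = t]) (use F M nn \<open>\<beta> > 0\<close> in auto)
    moreover have "(\<Sum>k\<in>F \<inter> ?S. L (exp (y - t k))) \<le> real (card (F \<inter> ?S)) * b"
      using b by (intro sum_bounded_above) auto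
    moreover have "real (card (F \<inter> ?S)) * b \<le> (2 / d + 1) * b"
    proof (rule mult_right_mono[OF _ b0])
      have "card (F \<inter> ?S) \<le> card ?S" using S by (intro card_mono) auto
      then show "real (card (F \<inter> ?S)) \<le> 2 / d + 1" using S by simp
    qed
    ultimately show ?thesis by simp
  qed
  moreover have "M + (2 / d + 1) * b + 1 > 0"
  proof -
    have "(2 / d + 1) * b \<ge> 0" using b0 \<open>d > 0\<close> by simp
    then show ?thesis using M0 by linarith
  qed
  ultimately show ?thesis by (rule that[rotated])
qed

section \<open>Sample means and the operator in logarithmic coordinates\<close>

text \<open>The prefactor is the reciprocal length of the interval, so this is the average of
  \<open>g\<close> over it; \<open>g\<close> will be \<open>f\<close> composed with exp.\<close>

definition sample_mean :: "(int \<Rightarrow> real) \<Rightarrow> real \<Rightarrow> (real \<Rightarrow> real) \<Rightarrow> int \<Rightarrow> real" where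
  "sample_mean t w g k = w / (t (k + 1) - t k) * (LBINT u:{t k / w..t (k + 1) / w}. g u)"

lemma Kantorovich_exp:
  "Kantorovich t chi w f (exp s)
     = (\<Sum>\<^sub>\<infinity>k\<in>UNIV. chi (exp (w * s - t k)) (sample_mean t w (\<lambda>u. f (exp u)) k))"
  unfolding Kantorovich_def sample_mean_def
  by (simp add: powr_def mult_exp_exp)

text \<open>Averaging preserves closeness to a constant. With v = g s this compares a mean with the
  value at s; with v = 0 it bounds the mean, and shows that it vanishes when e = 0.\<close>

lemma sample_mean_near:
  assumes cont: "continuous_on UNIV g" and "w > 0" and lt: "t k < t (k + 1)"
    and near: "\<And>u. t k / w \<le> u \<Longrightarrow> u \<le> t (k + 1) / w \<Longrightarrow> \<bar>g u - v\<bar> \<le> e"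
  shows "\<bar>sample_mean t w g k - v\<bar> \<le> e"
proof -
  let ?a = "t k / w" and ?b = "t (k + 1) / w"
  have ab: "?a < ?b" using assms by (simp add: divide_strict_right_mono)
  have cg: "continuous_on {?a..?b} g" using cont continuous_on_subset by blast
  have "(LBINT u:{?a..?b}. g u) = integral {?a..?b} g"
    by (rule set_borel_integral_eq_integral) (rule borel_integrable_atLeastAtMost', rule cg)
  moreover have "integral {?a..?b} (\<lambda>u. g u - v) = integral {?a..?b} g - (?b - ?a) * v"
    using ab by (subst integral_diff) (auto intro: integrable_continuous_real cg)
  moreover have "norm (integral {?a..?b} (\<lambda>u. g u - v)) \<le> e * (?b - ?a)"
    using ab near by (intro integral_bound continuous_intros cg) auto
  ultimately have le: "\<bar>(LBINT u:{?a..?b}. g u) - (?b - ?a) * v\<bar> \<le> e * (?b - ?a)" by simp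
  define l where "l = ?b - ?a"
  have l: "l > 0" using ab by (simp add: l_def)
  have q: "w / (t (k + 1) - t k) = 1 / l" using assms by (simp add: l_def field_simps)
  have "sample_mean t w g k - v = ((LBINT u:{?a..?b}. g u) - l * v) / l"
    unfolding sample_mean_def q using l by (simp add: field_simps)
  then have "\<bar>sample_mean t w g k - v\<bar> = \<bar>(LBINT u:{?a..?b}. g u) - l * v\<bar> / l"
    using l by simp
  also have "\<dots> \<le> e" using le l by (simp add: pos_divide_le_eq l_def)
  finally show ?thesis .
qed

text \<open>This reduces the series estimates below to finite sums: bounded partial sums of absolute
  values give absolute convergence.\<close>

lemma infsum_abs_bound:
  fixes d :: "'a \<Rightarrow> real"
  assumes "\<And>F. finite F \<Longrightarrow> (\<Sum>k\<in>F. \<bar>d k\<bar>) \<le> C"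
  shows "d summable_on UNIV" and "\<bar>infsum d UNIV\<bar> \<le> C"
proof -
  have abs: "(\<lambda>k. norm (d k)) summable_on UNIV"
    by (rule nonneg_bdd_above_summable_on) (use assms in \<open>auto intro!: bdd_aboveI2\<close>)
  then show "d summable_on UNIV" by (rule abs_summable_summable)
  have "norm (infsum d UNIV) \<le> infsum (\<lambda>k. norm (d k)) UNIV"
    using abs by (rule norm_infsum_bound)
  also have "\<dots> \<le> C" using abs assms by (intro infsum_le_finite_sums) auto
  finally show "\<bar>infsum d UNIV\<bar> \<le> C" by simp
qed

section \<open>Functions with compact support\<close>

lemma Cc_pos_exp:
  assumes "f \<in> Cc_pos"
  obtains R where "R > 0" "\<And>s. R < \<bar>s\<bar> \<Longrightarrow> f (exp s) = 0" "continuous_on UNIV (\<lambda>s. f (exp s))"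
proof -
  let ?K = "closure (support_on {0<..} f)"
  have f: "continuous_on {0<..} f" "compact ?K" "?K \<subseteq> {0<..}"
    using assms by (auto simp: Cc_pos_def)
  have "compact (ln ` ?K)"
    by (rule compact_continuous_image) (use f in \<open>auto intro!: continuous_intros\<close>)
  then obtain b where b: "\<And>x. x \<in> ?K \<Longrightarrow> \<bar>ln x\<bar> \<le> b"
    using compact_imp_bounded by (fastforce simp: bounded_iff)
  \<comment> \<open>For empty support \<open>b\<close> may be negative, hence the absolute value;
    the added 1 makes the radius positive.\<close>
  have "f (exp s) = 0" if "\<bar>b\<bar> + 1 < \<bar>s\<bar>" for s
  proof (rule ccontr)
    assume "f (exp s) \<noteq> 0"
    then have "exp s \<in> support_on {0<..} f" by (simp add: support_on_def)
    then have "exp s \<in> ?K" using closure_subset by blast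
    then have "\<bar>s\<bar> \<le> b" using b[of "exp s"] by simp
    then show False using that by linarith
  qed
  moreover have "continuous_on UNIV (\<lambda>s. f (exp s))"
    by (rule continuous_on_compose2[OF f(1)]) (auto intro!: continuous_intros)
  ultimately show ?thesis by (intro that[of "\<bar>b\<bar> + 1"]) auto
qed

lemma compact_support_bounded_uniformly_continuous:
  fixes g :: "real \<Rightarrow> real"
  assumes cont: "continuous_on UNIV g" and zero: "\<And>s. R < \<bar>s\<bar> \<Longrightarrow> g s = 0"
  shows "\<exists>b\<ge>0. \<forall>s. \<bar>g s\<bar> \<le> b" and "uniformly_continuous_on UNIV g"
proof -
  have "compact (g ` {-R..R})"
    by (rule compact_continuous_image) (auto intro: continuous_on_subset[OF cont])
  then obtain b where "\<And>s. s \<in> {-R..R} \<Longrightarrow> \<bar>g s\<bar> \<le> b"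
    using compact_imp_bounded by (fastforce simp: bounded_iff)
  then have "\<bar>g s\<bar> \<le> \<bar>b\<bar>" for s using zero[of s] by (cases "s \<in> {-R..R}") force+
  then show "\<exists>b\<ge>0. \<forall>s. \<bar>g s\<bar> \<le> b" by (intro exI[of _ "\<bar>b\<bar>"]) auto
  have "uniformly_continuous_on {-R - 1..R + 1} g"
    by (rule compact_uniformly_continuous) (auto intro: continuous_on_subset[OF cont])
  note u = this[unfolded uniformly_continuous_on_def]
  show "uniformly_continuous_on UNIV g"
    unfolding uniformly_continuous_on_def
  proof (intro allI impI)
    fix e :: real assume "e > 0"
    with u obtain d where d: "d > 0"
      "\<And>x x'. x \<in> {-R - 1..R + 1} \<Longrightarrow> x' \<in> {-R - 1..R + 1} \<Longrightarrow> dist x' x < d \<Longrightarrow> dist (g x') (g x) < e"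
      by meson
    \<comment> \<open>If one of the points leaves [-R - 1, R + 1], a distance below 1 keeps both
      outside [-R, R], where \<open>g\<close> vanishes.\<close>
    have "dist (g x') (g x) < e" if "dist x' x < min d 1" for x x'
    proof (cases "x \<in> {-R - 1..R + 1} \<and> x' \<in> {-R - 1..R + 1}")
      case True
      then show ?thesis using d that by simp
    next
      case False
      then have "R < \<bar>x\<bar>" "R < \<bar>x'\<bar>" using that by (auto simp: dist_real_def)
      then show ?thesis using zero \<open>e > 0\<close> by simp
    qed
    then show "\<exists>d>0. \<forall>x\<in>UNIV. \<forall>x'\<in>UNIV. dist x' x < d \<longrightarrow> dist (g x') (g x) < e"
      using d(1) by (intro exI[of _ "min d 1"]) auto
  qed
qed

section \<open>Uniform convergence of the operator\<close>

text \<open>Both asymptotic conditions are taken with j = 1. \<open>kernel_S\<close> controls the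
  absolute error for \<open>\<bar>v\<bar> < 1\<close>; \<open>kernel_T\<close> controls the relative
  error for the other v, and multiplication by \<open>\<bar>v\<bar> \<le> b\<close> makes it
  absolute.\<close>

lemma kernel_constants_uniform:
  assumes ker: "nonlinear_kernel t L \<psi> \<alpha> \<beta> chi" and "e > 0" and "b \<ge> 0"
  shows "\<forall>\<^sub>F w in at_top. \<forall>s v. \<bar>v\<bar> \<le> b \<longrightarrow>
    \<bar>(\<Sum>\<^sub>\<infinity>k\<in>UNIV. chi (exp (w * s - t k)) v) - v\<bar> \<le> e"
proof -
  have "\<alpha> > 0" using ker by (simp add: nonlinear_kernel_def)
  have "uniform_bigo_powr \<alpha> (kernel_S t chi 1)" "uniform_bigo_powr \<alpha> (kernel_T t chi 1)"
    using ker by (auto simp: nonlinear_kernel_def)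
  then obtain C D where
    C: "\<forall>\<^sub>F w in at_top. \<forall>x>0. kernel_S t chi 1 w x \<le> ennreal (C * w powr (- \<alpha>))" and
    D: "\<forall>\<^sub>F w in at_top. \<forall>x>0. kernel_T t chi 1 w x \<le> ennreal (D * w powr (- \<alpha>))"
    unfolding uniform_bigo_powr_def by blast
  \<comment> \<open>\<open>C\<close> and \<open>D\<close> come without a sign; a common nonnegative
    constant lets the \<open>ennreal\<close> bounds be read back in the reals.\<close>
  define E where "E = max (max C D) 0"
  have E: "E \<ge> 0" "C \<le> E" "D \<le> E" by (auto simp: E_def)
  have "((\<lambda>w. E * w powr (- \<alpha>) * (1 + b)) \<longlongrightarrow> E * 0 * (1 + b)) at_top"
    by (intro tendsto_intros tendsto_neg_powr filterlim_ident) (use \<open>\<alpha> > 0\<close> in auto)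
  then have "\<forall>\<^sub>F w in at_top. E * w powr (- \<alpha>) * (1 + b) < e"
    using \<open>e > 0\<close> by (auto dest: order_tendstoD)
  with C D show ?thesis
  proof eventually_elim
    case (elim w)
    let ?r = "E * w powr (- \<alpha>)"
    have r: "?r \<ge> 0" using E by simp
    show ?case
    proof (intro allI impI)
      fix s v :: real assume v: "\<bar>v\<bar> \<le> b"
      let ?Q = "\<Sum>\<^sub>\<infinity>k\<in>UNIV. chi (exp (- t k) * exp s powr w) v"
      have Q: "?Q = (\<Sum>\<^sub>\<infinity>k\<in>UNIV. chi (exp (w * s - t k)) v)"
        by (simp add: powr_def mult_exp_exp)
      have "\<bar>?Q - v\<bar> \<le> ?r * (1 + b)"
      proof (cases "\<bar>v\<bar> < 1")
        case True
        then have "ennreal \<bar>?Q - v\<bar> \<le> kernel_S t chi 1 w (exp s)"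
          unfolding kernel_S_def by (intro SUP_upper) auto
        also have "\<dots> \<le> ennreal (C * w powr (- \<alpha>))" using elim by simp
        also have "\<dots> \<le> ennreal ?r" using E by (intro ennreal_leI mult_right_mono) auto
        finally have "\<bar>?Q - v\<bar> \<le> ?r" using r by (simp add: ennreal_le_iff)
        also have "\<dots> \<le> ?r * (1 + b)" using mult_left_mono[of 1 "1 + b", OF _ r] \<open>b \<ge> 0\<close> by simp
        finally show ?thesis .
      next
        case False
        then have "ennreal \<bar>1 / v * ?Q - 1\<bar> \<le> kernel_T t chi 1 w (exp s)"
          unfolding kernel_T_def by (intro SUP_upper) auto
        also have "\<dots> \<le> ennreal (D * w powr (- \<alpha>))" using elim by simp
        also have "\<dots> \<le> ennreal ?r" using E by (intro ennreal_leI mult_right_mono) auto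
        finally have le: "\<bar>1 / v * ?Q - 1\<bar> \<le> ?r" using r by (simp add: ennreal_le_iff)
        have "?Q - v = v * (1 / v * ?Q - 1)" using False by (auto simp: field_simps)
        then have "\<bar>?Q - v\<bar> = \<bar>v\<bar> * \<bar>1 / v * ?Q - 1\<bar>" by (metis abs_mult)
        also have "\<dots> \<le> (1 + b) * ?r" using le v r \<open>b \<ge> 0\<close> by (intro mult_mono) auto
        finally show ?thesis by (simp add: mult.commute)
      qed
      then show "\<bar>(\<Sum>\<^sub>\<infinity>k\<in>UNIV. chi (exp (w * s - t k)) v) - v\<bar> \<le> e"
        using elim Q by simp
    qed
  qed
qed

lemma nonlinear_kernelD:
  assumes "nonlinear_kernel t L \<psi> \<alpha> \<beta> chi"
  shows "\<And>x. x > 0 \<Longrightarrow> L x \<ge> 0" and "\<And>u. u \<ge> 0 \<Longrightarrow> \<psi> u \<ge> 0"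
    and "mono_on {0..} \<psi>" and "continuous_on {0..} \<psi>" and "\<psi> 0 = 0" and "\<beta> > 0"
    and "\<And>x u w. x > 0 \<Longrightarrow> w > 0 \<Longrightarrow> (\<lambda>k. \<bar>chi (exp (- t k) * x powr w) u\<bar>) summable_on UNIV"
    and "\<And>x. x > 0 \<Longrightarrow> chi x 0 = 0"
    and "\<And>x u v. x > 0 \<Longrightarrow> \<bar>chi x u - chi x v\<bar> \<le> L x * \<psi> \<bar>u - v\<bar>"
    and "L \<in> borel_measurable (lebesgue_on {0<..})" and "integrable log_measure L"
    and "bounded (L ` {0<..})" and "abs_moment \<beta> t L < \<infinity>"
  using assms unfolding nonlinear_kernel_def by simp_all

text \<open>Three errors of size e / 3 add up: replacing the mean by g s for near indices, the same
  replacement for far indices, and the deviation of the kernel series at the constant g s from g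
  s.\<close>

lemma Kantorovich_uniform:
  fixes f :: "real \<Rightarrow> real"
  defines "g \<equiv> \<lambda>u. f (exp u)"
  assumes samp: "sampling_sequence t" and ker: "nonlinear_kernel t L \<psi> \<alpha> \<beta> chi"
    and cont: "continuous_on UNIV g" and uc: "uniformly_continuous_on UNIV g"
    and b: "b \<ge> 0" "\<And>s. \<bar>g s\<bar> \<le> b" and "e > 0"
  shows "\<forall>\<^sub>F w in at_top. \<forall>s. \<bar>Kantorovich t chi w f (exp s) - f (exp s)\<bar> \<le> e"
proof -
  obtain D d where D: "D > 0" "\<And>k. t (k + 1) - t k \<le> D"
    and d: "d > 0" "\<And>k. d \<le> t (k + 1) - t k"
    and lt: "\<And>k. t k < t (k + 1)"
    using samp unfolding sampling_sequence_def by blast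
  note nn = nonlinear_kernelD(1)[OF ker] and psi_nn = nonlinear_kernelD(2)[OF ker]
    and psi_mono = nonlinear_kernelD(3)[OF ker] and psi_cont = nonlinear_kernelD(4)[OF ker]
    and psi0 = nonlinear_kernelD(5)[OF ker] and \<beta> = nonlinear_kernelD(6)[OF ker]
    and summ = nonlinear_kernelD(7)[OF ker] and lip = nonlinear_kernelD(9)[OF ker]
    and bdd = nonlinear_kernelD(12)[OF ker] and mom = nonlinear_kernelD(13)[OF ker]
  obtain M where M: "M \<ge> 0"
    "\<And>y F. finite F \<Longrightarrow> (\<Sum>k\<in>F. L (exp (y - t k)) * \<bar>y - t k\<bar> powr \<beta>) \<le> M"
    using abs_moment_finite_sum[OF mom nn] by blast
  obtain M0 where M0: "M0 > 0" "\<And>y F. finite F \<Longrightarrow> (\<Sum>k\<in>F. L (exp (y - t k))) \<le> M0"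
    using kernel_sum_bounded[OF d(2,1) \<beta> nn bdd M(2)] by blast
  \<comment> \<open>For near indices the mean will be within \<eta> of g s, so that they contribute
    at most \<open>M0 * \<psi> \<eta>\<close>; continuity of \<psi> at 0 makes this small.\<close>
  obtain \<eta> where \<eta>: "\<eta> > 0" "\<psi> \<eta> * M0 \<le> e / 3"
  proof -
    have "e / (3 * M0) > 0" using \<open>e > 0\<close> M0 by simp
    then obtain r where r: "r > 0" "\<And>u. u \<ge> 0 \<Longrightarrow> dist u 0 < r \<Longrightarrow> dist (\<psi> u) (\<psi> 0) < e / (3 * M0)"
      using psi_cont unfolding continuous_on_iff by (metis atLeast_iff order_refl)
    have "\<psi> (r / 2) < e / (3 * M0)" using r(1) r(2)[of "r / 2"] psi0 by simp
    then have "\<psi> (r / 2) * M0 \<le> e / 3" using M0 by (simp add: field_simps)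
    then show ?thesis using r by (intro that[of "r / 2"]) auto
  qed
  obtain \<rho> where \<rho>: "\<rho> > 0" "\<And>x y. \<bar>x - y\<bar> < \<rho> \<Longrightarrow> \<bar>g x - g y\<bar> < \<eta>"
    using uc \<eta>(1) unfolding uniformly_continuous_on_def dist_real_def by (metis UNIV_I)
  \<comment> \<open>This is the bound for far indices: mean and g s differ by at most 2 b, and
    \<open>far_sum_le\<close> with r = w \<rho> / 2 produces the decaying power of w.\<close>
  have "((\<lambda>w. \<psi> (2 * b) * (M / (\<rho> / 2) powr \<beta>) * w powr (- \<beta>)) \<longlongrightarrow>
      \<psi> (2 * b) * (M / (\<rho> / 2) powr \<beta>) * 0) at_top"
    by (intro tendsto_intros tendsto_neg_powr filterlim_ident) (use \<beta> in auto)
  then have far_small: "\<forall>\<^sub>F w in at_top. \<psi> (2 * b) * (M / (\<rho> / 2) powr \<beta>) * w powr (- \<beta>) < e / 3"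
    using \<open>e > 0\<close> by (intro order_tendstoD(2)[where y = 0]) auto
  have e3: "e / 3 > 0" using \<open>e > 0\<close> by simp
  show ?thesis
    using far_small kernel_constants_uniform[OF ker e3 b(1)]
      eventually_gt_at_top[of "2 * D / \<rho>"] eventually_ge_at_top[of 1]
  proof eventually_elim
    case (elim w)
    have w: "w > 0" using elim by simp
    \<comment> \<open>Every averaging interval is shorter than \<rho> / 2. If its left endpoint
      \<open>t k / w\<close> is within \<rho> / 2 of s, the whole interval therefore lies within
      \<rho> of s.\<close>
    have Dw: "D / w < \<rho> / 2" using elim(3) \<rho>(1) w by (simp add: field_simps)
    show ?case
    proof
      fix s
      let ?a = "sample_mean t w g" and ?l = "\<lambda>k. L (exp (w * s - t k))"
      let ?d = "\<lambda>k. chi (exp (w * s - t k)) (?a k) - chi (exp (w * s - t k)) (g s)"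
      have near: "\<bar>?a k - g s\<bar> \<le> \<eta>" if "\<bar>w * s - t k\<bar> < w * \<rho> / 2" for k
      proof (rule sample_mean_near[OF cont w lt[of k]])
        fix u assume u: "t k / w \<le> u" "u \<le> t (k + 1) / w"
        have "t (k + 1) / w - t k / w \<le> D / w"
          using D(2)[of k] w by (simp add: diff_divide_distrib[symmetric] divide_right_mono)
        moreover have "\<bar>s - t k / w\<bar> < \<rho> / 2"
        proof -
          have "s - t k / w = (w * s - t k) / w" using w by (simp add: field_simps)
          then have "\<bar>s - t k / w\<bar> = \<bar>w * s - t k\<bar> / w" using w by simp
          then show ?thesis using that w by (simp add: field_simps)
        qed
        ultimately have "\<bar>u - s\<bar> < \<rho>" using u Dw by linarith
        then show "\<bar>g u - g s\<bar> \<le> \<eta>" using \<rho>(2) by (simp add: less_imp_le)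
      qed
      have all: "\<bar>?a k - g s\<bar> \<le> 2 * b" for k
      proof (rule sample_mean_near[OF cont w lt[of k]])
        show "\<bar>g u - g s\<bar> \<le> 2 * b" for u using b(2)[of u] b(2)[of s] by linarith
      qed
      have dle: "\<bar>?d k\<bar> \<le> ?l k * \<psi> z" if "\<bar>?a k - g s\<bar> \<le> z" for k z
      proof -
        have "\<bar>?d k\<bar> \<le> ?l k * \<psi> \<bar>?a k - g s\<bar>" by (rule lip) simp
        also have "\<dots> \<le> ?l k * \<psi> z"
          using that by (intro mult_left_mono nn mono_onD[OF psi_mono]) auto
        finally show ?thesis .
      qed
      have bound: "(\<Sum>k\<in>F. \<bar>?d k\<bar>) \<le> 2 * e / 3" if F: "finite F" for F
      proof -
        let ?N = "{k. \<bar>w * s - t k\<bar> < w * \<rho> / 2}"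
        have "(\<Sum>k\<in>F \<inter> ?N. \<bar>?d k\<bar>) \<le> (\<Sum>k\<in>F \<inter> ?N. ?l k * \<psi> \<eta>)"
          by (intro sum_mono dle near) simp
        also have "\<dots> = (\<Sum>k\<in>F \<inter> ?N. ?l k) * \<psi> \<eta>" by (simp add: sum_distrib_right)
        also have "\<dots> \<le> M0 * \<psi> \<eta>"
          using F psi_nn[of \<eta>] \<eta>(1) by (intro mult_right_mono M0) auto
        also have "\<dots> \<le> e / 3" using \<eta>(2) by (simp add: mult.commute)
        finally have 1: "(\<Sum>k\<in>F \<inter> ?N. \<bar>?d k\<bar>) \<le> e / 3" .
        have "(\<Sum>k\<in>F - ?N. \<bar>?d k\<bar>) \<le> (\<Sum>k\<in>F - ?N. ?l k * \<psi> (2 * b))"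
          by (intro sum_mono dle all)
        also have "\<dots> = (\<Sum>k\<in>F - ?N. ?l k) * \<psi> (2 * b)" by (simp add: sum_distrib_right)
        also have "\<dots> \<le> (M / (w * \<rho> / 2) powr \<beta>) * \<psi> (2 * b)"
          using F psi_nn[of "2 * b"] b(1) M(2) nn w \<rho>(1) \<beta>
          by (intro mult_right_mono far_sum_le[where y = "w * s" and t = t]) auto
        also have "\<dots> = \<psi> (2 * b) * (M / (\<rho> / 2) powr \<beta>) * w powr (- \<beta>)"
        proof -
          have "(w * \<rho> / 2) powr \<beta> = w powr \<beta> * (\<rho> / 2) powr \<beta>"
            using w \<rho>(1) powr_mult[of w "\<rho> / 2" \<beta>] by simp
          then show ?thesis by (simp add: powr_minus_divide mult_ac)
        qed
        also have "\<dots> \<le> e / 3" using elim by simp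
        finally have 2: "(\<Sum>k\<in>F - ?N. \<bar>?d k\<bar>) \<le> e / 3" .
        have "(\<Sum>k\<in>F. \<bar>?d k\<bar>) = (\<Sum>k\<in>F \<inter> ?N. \<bar>?d k\<bar>) + (\<Sum>k\<in>F - ?N. \<bar>?d k\<bar>)"
          using F by (rule sum.Int_Diff)
        then show ?thesis using 1 2 by linarith
      qed
      note dsum = infsum_abs_bound[of ?d, OF bound]
      \<comment> \<open>The series at the constant g s converges by the absolute summability
        required of the kernel, so the operator splits into this series and that of
        \<open>?d\<close>.\<close>
      have "(\<lambda>k. \<bar>chi (exp (- t k) * exp s powr w) (g s)\<bar>) summable_on UNIV"
        using w by (intro summ) auto
      then have csum: "(\<lambda>k. chi (exp (w * s - t k)) (g s)) summable_on UNIV"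
        using abs_summable_summable[of "\<lambda>k. chi (exp (w * s - t k)) (g s)" UNIV]
        by (simp add: powr_def mult_exp_exp)
      have "Kantorovich t chi w f (exp s)
          = (\<Sum>\<^sub>\<infinity>k\<in>UNIV. ?d k + chi (exp (w * s - t k)) (g s))"
        unfolding Kantorovich_exp g_def by simp
      also have "\<dots> = infsum ?d UNIV + (\<Sum>\<^sub>\<infinity>k\<in>UNIV. chi (exp (w * s - t k)) (g s))"
        by (rule infsum_add[OF dsum(1) csum])
      finally have "Kantorovich t chi w f (exp s) - g s
          = infsum ?d UNIV + ((\<Sum>\<^sub>\<infinity>k\<in>UNIV. chi (exp (w * s - t k)) (g s)) - g s)" by simp
      moreover have "\<bar>(\<Sum>\<^sub>\<infinity>k\<in>UNIV. chi (exp (w * s - t k)) (g s)) - g s\<bar> \<le> e / 3"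
        using elim(2) b(2) by blast
      ultimately have "\<bar>Kantorovich t chi w f (exp s) - g s\<bar> \<le> e" using dsum(2) by linarith
      then show "\<bar>Kantorovich t chi w f (exp s) - f (exp s)\<bar> \<le> e" by (simp add: g_def)
    qed
  qed
qed

section \<open>Estimates away from the support\<close>

text \<open>Since steps are at most w, averaging intervals have length at most 1, and one that meets
  [-R, R] has its index in \<open>S\<close>. All other means vanish; because
  \<open>chi x 0 = 0\<close>, comparing with the value 0 bounds each remaining term by
  \<open>\<psi> b\<close> times \<open>L\<close>.\<close>

lemma Kantorovich_abs_le:
  fixes f :: "real \<Rightarrow> real"
  defines "g \<equiv> \<lambda>u. f (exp u)"
  assumes ker: "nonlinear_kernel t L \<psi> \<alpha> \<beta> chi"
    and lt: "\<And>k. t k < t (k + 1)" and step: "\<And>k. t (k + 1) - t k \<le> w"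
    and cont: "continuous_on UNIV g" and b: "b \<ge> 0" "\<And>s. \<bar>g s\<bar> \<le> b"
    and zero: "\<And>s. R < \<bar>s\<bar> \<Longrightarrow> g s = 0" and "w > 0"
    and S: "S = {k. - (w * (R + 1)) \<le> t k \<and> t k \<le> w * (R + 1)}" "finite S"
  shows "\<bar>Kantorovich t chi w f (exp s)\<bar> \<le> \<psi> b * (\<Sum>k\<in>S. L (exp (w * s - t k)))"
proof -
  note nn = nonlinear_kernelD(1)[OF ker] and psi_nn = nonlinear_kernelD(2)[OF ker]
    and psi_mono = nonlinear_kernelD(3)[OF ker]
    and chi0 = nonlinear_kernelD(8)[OF ker] and lip = nonlinear_kernelD(9)[OF ker]
  let ?a = "sample_mean t w g" and ?l = "\<lambda>k. L (exp (w * s - t k))"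
  have a0: "?a k = 0" if "k \<notin> S" for k
  proof -
    have "\<bar>?a k - 0\<bar> \<le> 0"
    proof (rule sample_mean_near[OF cont \<open>w > 0\<close> lt[of k]])
      fix u assume u: "t k / w \<le> u" "u \<le> t (k + 1) / w"
      then have u': "t k \<le> w * u" "w * u \<le> t (k + 1)"
        using \<open>w > 0\<close> by (simp_all add: field_simps)
      have "w * (R + 1) < t k \<or> t k < - (w * (R + 1))" using that S by auto
      \<comment> \<open>On the left of the support the interval extends towards it, and the step
        bound keeps \<open>t (k + 1)\<close> below -w R.\<close>
      then have "w * R < w * u \<or> w * u < w * (- R)"
        using u' step[of k] \<open>w > 0\<close> unfolding distrib_left mult_minus_right by linarith
      then have "R < u \<or> u < - R" unfolding mult_less_cancel_left_pos[OF \<open>w > 0\<close>] .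
      then have "R < \<bar>u\<bar>" by linarith
      then show "\<bar>g u - 0\<bar> \<le> 0" using zero by simp
    qed
    then show ?thesis by simp
  qed
  have ab: "\<bar>?a k\<bar> \<le> b" for k
    using sample_mean_near[OF cont \<open>w > 0\<close> lt[of k], of 0 b] b by simp
  have le: "\<bar>chi (exp (w * s - t k)) (?a k)\<bar> \<le> ?l k * \<psi> b" for k
  proof -
    have "\<bar>chi (exp (w * s - t k)) (?a k) - chi (exp (w * s - t k)) 0\<bar> \<le> ?l k * \<psi> \<bar>?a k - 0\<bar>"
      by (rule lip) simp
    also have "\<dots> \<le> ?l k * \<psi> b"
      using ab b(1) by (intro mult_left_mono nn mono_onD[OF psi_mono]) auto
    finally show ?thesis by (simp add: chi0)
  qed
  have "\<bar>\<Sum>\<^sub>\<infinity>k\<in>UNIV. chi (exp (w * s - t k)) (?a k)\<bar> \<le> \<psi> b * (\<Sum>k\<in>S. ?l k)"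
  proof (rule infsum_abs_bound(2))
    fix F :: "int set" assume F: "finite F"
    have "(\<Sum>k\<in>F. \<bar>chi (exp (w * s - t k)) (?a k)\<bar>)
        = (\<Sum>k\<in>F \<inter> S. \<bar>chi (exp (w * s - t k)) (?a k)\<bar>)"
      using F a0 by (intro sum.mono_neutral_right) (auto simp: chi0)
    also have "\<dots> \<le> (\<Sum>k\<in>F \<inter> S. ?l k * \<psi> b)" by (intro sum_mono le)
    also have "\<dots> \<le> (\<Sum>k\<in>S. ?l k * \<psi> b)"
      using S(2) nn psi_nn b(1) by (intro sum_mono2) auto
    also have "\<dots> = \<psi> b * (\<Sum>k\<in>S. ?l k)" by (simp add: sum_distrib_left mult.commute)
    finally show "(\<Sum>k\<in>F. \<bar>chi (exp (w * s - t k)) (?a k)\<bar>) \<le> \<psi> b * (\<Sum>k\<in>S. ?l k)" .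
  qed
  then show ?thesis unfolding Kantorovich_exp g_def .
qed

text \<open>The affine change of variable gives each term the factor 1 / w, which cancels against
  the at most C w terms.\<close>

lemma nn_integral_sum_translates:
  fixes G :: "real \<Rightarrow> ennreal" and t :: "'a \<Rightarrow> real"
  assumes [measurable]: "G \<in> borel_measurable borel" and "w > 0" and card: "real (card S) \<le> C * w"
  shows "(\<integral>\<^sup>+ s. (\<Sum>k\<in>S. G (w * s - t k)) \<partial>lborel) \<le> ennreal C * (\<integral>\<^sup>+ s. G s \<partial>lborel)"
proof -
  let ?T = "\<integral>\<^sup>+ s. G s \<partial>lborel"
  have I: "(\<integral>\<^sup>+ s. G (w * s - t k) \<partial>lborel) = ennreal (1 / w) * ?T" for k
  proof -
    have "?T = ennreal \<bar>w\<bar> * (\<integral>\<^sup>+ s. G (- t k + w * s) \<partial>lborel)"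
      by (rule nn_integral_real_affine) (use \<open>w > 0\<close> in auto)
    then have "ennreal (1 / w) * ?T = (ennreal (1 / w) * ennreal w) * (\<integral>\<^sup>+ s. G (w * s - t k) \<partial>lborel)"
      using \<open>w > 0\<close> by (simp add: mult.assoc)
    also have "ennreal (1 / w) * ennreal w = 1"
      using \<open>w > 0\<close> by (simp add: ennreal_mult[symmetric])
    finally show ?thesis by simp
  qed
  have "(\<integral>\<^sup>+ s. (\<Sum>k\<in>S. G (w * s - t k)) \<partial>lborel) = (\<Sum>k\<in>S. \<integral>\<^sup>+ s. G (w * s - t k) \<partial>lborel)"
    by (rule nn_integral_sum) measurable
  also have "\<dots> = ennreal (real (card S)) * (ennreal (1 / w) * ?T)"
    by (simp add: I ennreal_of_nat_eq_real_of_nat)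
  also have "\<dots> = ennreal (real (card S) / w) * ?T"
    using \<open>w > 0\<close> by (simp add: mult.assoc[symmetric] ennreal_mult[symmetric])
  also have "\<dots> \<le> ennreal C * ?T"
    using card \<open>w > 0\<close> by (intro mult_right_mono ennreal_leI) (auto simp: field_simps)
  finally show ?thesis .
qed

section \<open>Convergence in the modular\<close>

theorem theorem11:
  fixes t :: "int \<Rightarrow> real" and L \<psi> \<phi> f :: "real \<Rightarrow> real" and \<alpha> \<beta> c :: real
    and chi :: "real \<Rightarrow> real \<Rightarrow> real"
  assumes "sampling_sequence t"
    and "nonlinear_kernel t L \<psi> \<alpha> \<beta> chi"
    and "phi_function \<phi>" and "convex_on {0..} \<phi>"
    and "f \<in> Cc_pos" and "c > 0"
  shows "((\<lambda>w. log_modular \<phi> (\<lambda>x. c * (Kantorovich t chi w f x - f x))) \<longlongrightarrow> 0) at_top"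
proof (rule order_tendstoI)
  fix e :: ennreal assume "0 < e"
  \<comment> \<open>\<open>e\<close> may be infinite; a finite positive \<open>e'\<close> below it
    can be halved between the two regions.\<close>
  then obtain e' where e': "e' > 0" "ennreal e' < e"
    by (metis dense ennreal_cases ennreal_less_zero_iff less_top_ennreal less_trans top.not_eq_extremum)
  obtain D d where D: "D > 0" "\<And>k. t (k + 1) - t k \<le> D"
    and d: "d > 0" "\<And>k. d \<le> t (k + 1) - t k"
    and lt: "\<And>k. t k < t (k + 1)"
    using assms(1) unfolding sampling_sequence_def by blast
  note nn = nonlinear_kernelD(1)[OF assms(2)] and psi_nn = nonlinear_kernelD(2)[OF assms(2)]
    and \<beta> = nonlinear_kernelD(6)[OF assms(2)]
    and Lmeas = nonlinear_kernelD(10)[OF assms(2)] and Lint = nonlinear_kernelD(11)[OF assms(2)]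
    and bdd = nonlinear_kernelD(12)[OF assms(2)] and mom = nonlinear_kernelD(13)[OF assms(2)]
  have phi_nn: "\<And>u. u \<ge> 0 \<Longrightarrow> \<phi> u \<ge> 0" and phi_mono: "mono_on {0..} \<phi>"
    and phi_cont: "continuous_on {0..} \<phi>" and phi0: "\<phi> 0 = 0"
    using assms(3) unfolding phi_function_def by simp_all
  obtain M where M: "M \<ge> 0"
    "\<And>y F. finite F \<Longrightarrow> (\<Sum>k\<in>F. L (exp (y - t k)) * \<bar>y - t k\<bar> powr \<beta>) \<le> M"
    using abs_moment_finite_sum[OF mom nn] by blast
  obtain M0 where M0: "M0 > 0" "\<And>y F. finite F \<Longrightarrow> (\<Sum>k\<in>F. L (exp (y - t k))) \<le> M0"
    using kernel_sum_bounded[OF d(2,1) \<beta> nn bdd M(2)] by blast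
  obtain G where G[measurable]: "G \<in> borel_measurable borel"
    and GL: "\<And>s. ennreal (L (exp s)) \<le> G s" and Gfin: "(\<integral>\<^sup>+ s. G s \<partial>lborel) < \<infinity>"
    using borel_majorant_log_measure[OF Lmeas Lint] by blast
  obtain R where R: "R > 0" and zero: "\<And>s. R < \<bar>s\<bar> \<Longrightarrow> f (exp s) = 0"
    and cont: "continuous_on UNIV (\<lambda>s. f (exp s))"
    using Cc_pos_exp[OF assms(5)] by blast
  note cs = compact_support_bounded_uniformly_continuous[of "\<lambda>s. f (exp s)" R]
  have uc: "uniformly_continuous_on UNIV (\<lambda>s. f (exp s))"
    using cs(2) cont zero by blast
  obtain b where b: "b \<ge> 0" "\<And>s. \<bar>f (exp s)\<bar> \<le> b"
    using cs(1) cont zero by blast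
  \<comment> \<open>Indices in the set \<open>S\<close> below satisfy
    \<open>\<bar>t k\<bar> \<le> w * (R + 1)\<close>, so \<open>\<bar>s\<bar> > R + 2\<close> leaves
    the gap \<open>\<bar>w * s - t k\<bar> > w\<close>.\<close>
  define R' where "R' = R + 2"
  have R': "R' > 0" using R by (simp add: R'_def)
  \<comment> \<open>2 R' is the length of [-R', R'], so a uniform error \<epsilon> costs at most e'
    / 2 there. The witness r / (2 c) turns c \<epsilon> into r / 2.\<close>
  obtain \<epsilon> where \<epsilon>: "\<epsilon> > 0" "\<phi> (c * \<epsilon>) * (2 * R') \<le> e' / 2"
  proof -
    have "e' / (4 * R') > 0" using e' R' by simp
    then obtain r where r: "r > 0" "\<And>u. u \<ge> 0 \<Longrightarrow> dist u 0 < r \<Longrightarrow> dist (\<phi> u) (\<phi> 0) < e' / (4 * R')"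
      using phi_cont unfolding continuous_on_iff by (metis atLeast_iff order_refl)
    have "\<phi> (c * (r / (2 * c))) < e' / (4 * R')"
      using r(1) r(2)[of "r / 2"] phi0 \<open>c > 0\<close> by simp
    then have "\<phi> (c * (r / (2 * c))) * (2 * R') \<le> e' / 2" using R' by (simp add: field_simps)
    then show ?thesis using r \<open>c > 0\<close> by (intro that[of "r / (2 * c)"]) auto
  qed
  \<comment> \<open>\<open>y0\<close> bounds c times the operator away from the support, as the
    kernel sums are at most \<open>M0\<close>. \<open>D0\<close> is the factor in front of the
    kernel sum once convexity has been applied between 0 and \<open>y0\<close>.\<close>
  define y0 where "y0 = c * \<psi> b * M0"
  have y0: "y0 \<ge> 0" using \<open>c > 0\<close> M0 psi_nn[OF b(1)] by (simp add: y0_def)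
  define D0 where "D0 = \<phi> y0 / M0"
  have D0: "D0 \<ge> 0" using phi_nn[OF y0] M0 by (simp add: D0_def)
  \<comment> \<open>For w \<ge> 1 the count 2 w (R + 1) / d + 1 of the indices in \<open>S\<close>
    is at most C w.\<close>
  define C where "C = 2 * (R + 1) / d + 1"
  define Gt where "Gt w s = G s * indicator {s. w < \<bar>s\<bar>} s" for w s
  have [measurable]: "Gt w \<in> borel_measurable borel" for w unfolding Gt_def by measurable
  have "((\<lambda>w. (ennreal D0 * ennreal C) * (\<integral>\<^sup>+ s. Gt w s \<partial>lborel)) \<longlongrightarrow> (ennreal D0 * ennreal C) * 0) at_top"
    unfolding Gt_def
    by (intro ennreal_tendsto_cmult tendsto_nn_integral_tail G Gfin) (simp add: ennreal_mult_less_top)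
  then have tail: "\<forall>\<^sub>F w in at_top. (ennreal D0 * ennreal C) * (\<integral>\<^sup>+ s. Gt w s \<partial>lborel) < ennreal (e' / 2)"
    using e' by (intro order_tendstoD(2)[where y = 0]) auto
  show "\<forall>\<^sub>F w in at_top. log_modular \<phi> (\<lambda>x. c * (Kantorovich t chi w f x - f x)) < e"
    \<comment> \<open>w \<ge> D makes all steps at most w, as \<open>Kantorovich_abs_le\<close>
      requires; w \<ge> 1 absorbs the additive 1 in the index count.\<close>
    using tail Kantorovich_uniform[OF assms(1,2) cont uc b \<epsilon>(1)]
      eventually_ge_at_top[of D] eventually_ge_at_top[of 1]
  proof eventually_elim
    case (elim w)
    have w: "w > 0" using elim by simp
    define S where "S = {k. - (w * (R + 1)) \<le> t k \<and> t k \<le> w * (R + 1)}"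
    have S: "finite S" "real (card S) \<le> C * w"
    proof -
      have "- (w * (R + 1)) \<le> w * (R + 1)" using w R by simp
      note sp = spaced_points_in_interval[of d t, OF d(2,1) this, folded S_def]
      show "finite S" by (rule sp)
      have "real (card S) \<le> 2 * w * (R + 1) / d + 1" using sp(2) by simp
      also have "\<dots> \<le> C * w" using elim(4) by (simp add: C_def algebra_simps)
      finally show "real (card S) \<le> C * w" .
    qed
    \<comment> \<open>A Borel majorant of the integrand on the whole line: the first summand serves
      [-R', R'], the second its complement.\<close>
    define H where "H s = ennreal (\<phi> (c * \<epsilon>)) * indicator {-R'..R'} s
      + ennreal D0 * (\<Sum>k\<in>S. Gt w (w * s - t k))" for s
    have [measurable]: "H \<in> borel_measurable borel" unfolding H_def by measurable
    have "ennreal (\<phi> \<bar>c * (Kantorovich t chi w f (exp s) - f (exp s))\<bar>) \<le> H s" for s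
    proof (cases "\<bar>s\<bar> \<le> R'")
      case True
      have "\<phi> \<bar>c * (Kantorovich t chi w f (exp s) - f (exp s))\<bar> \<le> \<phi> (c * \<epsilon>)"
        using elim(2) \<open>c > 0\<close> \<epsilon>(1) by (intro mono_onD[OF phi_mono]) (auto simp: abs_mult)
      then have "ennreal (\<phi> \<bar>c * (Kantorovich t chi w f (exp s) - f (exp s))\<bar>) \<le> ennreal (\<phi> (c * \<epsilon>))"
        by (rule ennreal_leI)
      also have "\<dots> \<le> H s" using True by (auto simp: H_def indicator_def)
      finally show ?thesis .
    next
      case False
      let ?l = "\<lambda>k. L (exp (w * s - t k))"
      \<comment> \<open>The kernel sum is normalised by its bound \<open>M0\<close> to give a weight
        in [0, 1] for the convexity inequality.\<close>
      define \<theta> where "\<theta> = (\<Sum>k\<in>S. ?l k) / M0"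
      have \<theta>: "0 \<le> \<theta>" "\<theta> \<le> 1"
        using M0(1) M0(2)[OF S(1), of "w * s"] by (auto simp: \<theta>_def intro!: divide_nonneg_nonneg sum_nonneg nn)
      have "\<bar>Kantorovich t chi w f (exp s)\<bar> \<le> \<psi> b * (\<Sum>k\<in>S. ?l k)"
        by (rule Kantorovich_abs_le[OF assms(2) lt _ cont b zero w S_def S(1)])
          (use D(2) elim(3) order_trans in blast)+
      then have "c * \<bar>Kantorovich t chi w f (exp s)\<bar> \<le> \<theta> * y0"
        using \<open>c > 0\<close> M0(1) by (simp add: \<theta>_def y0_def mult.commute)
      moreover have "f (exp s) = 0" using False by (intro zero) (simp add: R'_def)
      ultimately have "\<phi> \<bar>c * (Kantorovich t chi w f (exp s) - f (exp s))\<bar> \<le> \<phi> (\<theta> * y0)"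
        using \<theta> y0 \<open>c > 0\<close> by (intro mono_onD[OF phi_mono]) (auto simp: abs_mult)
      \<comment> \<open>Convexity between 0 and \<open>y0\<close> with \<open>\<phi> 0 = 0\<close>
        makes the bound linear in \<theta>, hence in the kernel sum, which can be integrated term by
        term.\<close>
      also have "\<dots> \<le> \<theta> * \<phi> y0"
        using convex_onD[OF assms(4) \<theta>, of 0 y0] y0 by (simp add: phi0)
      also have "\<dots> = D0 * (\<Sum>k\<in>S. ?l k)" by (simp add: \<theta>_def D0_def)
      finally have "ennreal (\<phi> \<bar>c * (Kantorovich t chi w f (exp s) - f (exp s))\<bar>)
          \<le> ennreal (D0 * (\<Sum>k\<in>S. ?l k))" by (rule ennreal_leI)
      also have "\<dots> = ennreal D0 * (\<Sum>k\<in>S. ennreal (?l k))"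
        using D0 by (simp add: ennreal_mult' sum_ennreal nn)
      also have "\<dots> \<le> ennreal D0 * (\<Sum>k\<in>S. Gt w (w * s - t k))"
      proof (intro mult_left_mono sum_mono)
        fix k assume "k \<in> S"
        then have "\<bar>t k\<bar> \<le> w * (R + 1)" by (auto simp: S_def)
        moreover have "w * (R + 2) < \<bar>w * s\<bar>"
          using False w by (simp add: abs_mult R'_def)
        ultimately have "w < \<bar>w * s - t k\<bar>" by (simp add: algebra_simps)
        then show "ennreal (?l k) \<le> Gt w (w * s - t k)" using GL by (simp add: Gt_def)
      qed simp
      also have "\<dots> \<le> H s" by (simp add: H_def)
      finally show ?thesis .
    qed
    then have "log_modular \<phi> (\<lambda>x. c * (Kantorovich t chi w f x - f x)) \<le> (\<integral>\<^sup>+ s. H s \<partial>lborel)"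
      by (intro log_modular_le) auto
    also have "\<dots> = ennreal (\<phi> (c * \<epsilon>)) * ennreal (2 * R')
        + ennreal D0 * (\<integral>\<^sup>+ s. (\<Sum>k\<in>S. Gt w (w * s - t k)) \<partial>lborel)"
      unfolding H_def using R' by (simp add: nn_integral_add nn_integral_cmult)
    also have "\<dots> \<le> ennreal (e' / 2) + ennreal D0 * (ennreal C * (\<integral>\<^sup>+ s. Gt w s \<partial>lborel))"
    proof (intro add_mono mult_left_mono nn_integral_sum_translates)
      show "ennreal (\<phi> (c * \<epsilon>)) * ennreal (2 * R') \<le> ennreal (e' / 2)"
        using \<epsilon>(2) R' phi_nn[of "c * \<epsilon>"] \<epsilon>(1) \<open>c > 0\<close>
        by (simp add: ennreal_mult[symmetric] ennreal_leI)
    qed (use w S in auto)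
    also have "\<dots> \<le> ennreal (e' / 2) + ennreal (e' / 2)"
      using elim(1) by (intro add_left_mono) (simp add: mult.assoc)
    also have "\<dots> = ennreal e'" using e'(1) by (simp flip: ennreal_plus)
    also note e'(2)
    finally show ?case .
  qed
qed simp

end
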